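(* Let $n\ge 2$ be an integer with a partition $n=\sum_{k=1}^{\tau} n_k$, where $n_k\ge 1$ are integers and $n_k\ge m_k:=\sum_{i=k+1}^{\tau} n_i$ for all $k\in[\tau-1]$, and put $m_0:=n$. Let $\{\widetilde A^{(k)}\}_{k=1}^{\tau}$ be the scaled HB sequence associated with the DSHB factor of $J$ (constructed in the context). For $k\in[\tau-1]$ define $$T^{(k)}:=\begin{bmatrix}\widetilde A^{(k)}_{11}&\widetilde A^{(k)}_{12}\\ (\widetilde A^{(k)}_{12})^{\mathsf T}&\tfrac{m_k}{m_{k-1}}I_{m_k}\end{bmatrix}\in\mathbb{R}^{m_{k-1}\times m_{k-1}},$$ and $T^{(\tau)}:=\widetilde A^{(\tau)}=I_{n_\tau}$. For $k\in[\tau]$ define the augmented matrices $$\widehat T^{(k)}=I_{n_1}\oplus I_{n_2}\oplus\cdots\oplus I_{n_{k-1}}\oplus T^{(k)}\in\mathbb{R}^{n\times n}.$$ Then the matrices $\{T^{(k)}\}_{k=1}^{\tau}$ and $\{\widehat T^{(k)}\}_{k=1}^{\tau}$ are all symmetric and doubly stochastic, and the matrix $J=\frac1n\mathbf 1_n\mathbf 1_n^{\mathsf T}$ can be factored as $$J=J_0A_{\mathrm L}J_0=J_0A_{\mathrm R}J_0,$$ where $$A_{\mathrm L}:=\widehat T^{(1)}\widehat T^{(2)}\cdots\widehat T^{(\tau)}=T^{(1)}\cdot(I_{n_1}\oplus(T^{(2)}\cdot(I_{n_2}\oplus\cdots(T^{(\tau-1)}\cdot(I_{n_{\tau-1}}\oplus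 T^{(\tau)}))))),$$ $$A_{\mathrm R}:=\widehat T^{(\tau)}\widehat T^{(\tau-1)}\cdots\widehat T^{(1)}=(I_{n_1}\oplus\cdots\oplus(I_{n_{\tau-2}}\oplus(I_{n_{\tau-1}}\oplus T^{(\tau)})\cdot T^{(\tau-1)})\cdot T^{(\tau-2)}\cdots)\cdot T^{(1)}.$$ In addition, both factors $A_{\mathrm L}$ and $A_{\mathrm R}$ are doubly stochastic.
   Context: Notation: $[r]=\{1,\ldots,r\}$. $\mathbf{1}_r$ is the all-ones column vector in $\mathbb{R}^r$, $I_r$ the $r\times r$ identity. $J_k=\frac1{n_k}\mathbf{1}_{n_k}\mathbf{1}_{n_k}^{\mathsf T}\in\mathbb{R}^{n_k\times n_k}$, and $J_0=J_1\oplus\cdots\oplus J_\tau$, where $\oplus$ is the direct sum (block diagonal matrix). Note $m_{\tau-1}=n_\tau$. A square matrix $A$ is doubly stochastic if all its entries are nonnegative, $A\mathbf 1=\mathbf 1$ and $A^{\mathsf T}\mathbf 1=\mathbf 1$. DSHB (doubly stochastic hierarchically banded) factor and scaled HB sequence: the matrices $\widetilde A^{(k)}\in\mathbb{R}^{m_{k-1}\times m_{k-1}}$, $k\in[\tau]$, are defined recursively by $\widetilde A^{(\tau)}=I_{n_\tau}$, and for $k\in[\tau-1]$ $$\widetilde A^{(k)}=\begin{bmatrix}\widetilde A^{(k)}_{11}&\widetilde A^{(k)}_{12}\\ (\widetilde A^{(k)}_{12})^{\mathsf T}&\widetilde A^{(k)}_{22}\end{bmatrix},\qquad \widetilde A^{(k)}_{22}=\tfrac{m_k}{m_{k-1}}\widetilde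 A^{(k+1)},$$ where $\widetilde A^{(k)}_{11}=\operatorname{diag}\big(\underbrace{\tfrac{m_k}{m_{k-1}},\ldots,\tfrac{m_k}{m_{k-1}}}_{m_k},\underbrace{1,\ldots,1}_{n_k-m_k}\big)\in\mathbb{R}^{n_k\times n_k}$ and $\widetilde A^{(k)}_{12}\in\mathbb{R}^{n_k\times m_k}$ has entries $\widetilde A^{(k)}_{12}[i,j]=\frac{n_k}{m_{k-1}}$ if $i=j\in\{1,\ldots,m_k\}$ and $0$ otherwise. The DSHB factor of $J$ is $A:=\widetilde A^{(1)}$. In the nested product for $A_{\mathrm R}$, at each level the direct sum $I_{n_k}\oplus(\cdot)$ is formed and then multiplied on the right by $T^{(k)}$. *)

theory Defs
  imports Complex_Main "Jordan_Normal_Form.Matrix"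
begin

definition ones :: "nat \<Rightarrow> real vec" where
  "ones r = vec r (\<lambda>_. 1)"

definition doubly_stochastic :: "real mat \<Rightarrow> bool" where
  "doubly_stochastic A \<longleftrightarrow>
     square_mat A \<and>
     (\<forall>i < dim_row A. \<forall>j < dim_col A. 0 \<le> A $$ (i, j)) \<and>
     A *\<^sub>v ones (dim_col A) = ones (dim_row A) \<and>
     transpose_mat A *\<^sub>v ones (dim_row A) = ones (dim_col A)"

definition symmetric :: "real mat \<Rightarrow> bool" where
  "symmetric A \<longleftrightarrow> transpose_mat A = A"

definition averaging_mat :: "nat \<Rightarrow> real mat" where
  "averaging_mat r =
     (1 / real r) \<cdot>\<^sub>m (mat_of_cols r [ones r] * transpose_mat (mat_of_cols r [ones r]))"

(* The partition is (ns 1, ..., ns \<tau>); values of ns at other indices are never used.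
   The value at k = 0 is the full sum n. *)
definition tail_sum :: "(nat \<Rightarrow> nat) \<Rightarrow> nat \<Rightarrow> nat \<Rightarrow> nat" where
  "tail_sum ns \<tau> k = (\<Sum>i = k + 1..\<tau>. ns i)"

(* Block and partition labels k start at 1; matrix rows and columns are indexed from 0. *)
definition hb11 :: "(nat \<Rightarrow> nat) \<Rightarrow> nat \<Rightarrow> nat \<Rightarrow> real mat" where
  "hb11 ns \<tau> k = mat_diag (ns k)
     (\<lambda>i. if i < tail_sum ns \<tau> k then real (tail_sum ns \<tau> k) / real (tail_sum ns \<tau> (k - 1)) else 1)"

definition hb12 :: "(nat \<Rightarrow> nat) \<Rightarrow> nat \<Rightarrow> nat \<Rightarrow> real mat" where
  "hb12 ns \<tau> k = mat (ns k) (tail_sum ns \<tau> k)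
     (\<lambda>(i, j). if i = j then real (ns k) / real (tail_sum ns \<tau> (k - 1)) else 0)"

(* The scaled HB sequence; its member at k = 1 is the DSHB factor.
   Only 1 \<le> k \<le> \<tau> is meaningful. *)
function scaled_hb :: "(nat \<Rightarrow> nat) \<Rightarrow> nat \<Rightarrow> nat \<Rightarrow> real mat" where
  "scaled_hb ns \<tau> k =
     (if k < \<tau>
      then four_block_mat
             (hb11 ns \<tau> k) (hb12 ns \<tau> k)
             (transpose_mat (hb12 ns \<tau> k))
             ((real (tail_sum ns \<tau> k) / real (tail_sum ns \<tau> (k - 1))) \<cdot>\<^sub>m scaled_hb ns \<tau> (k + 1))
      else 1\<^sub>m (ns \<tau>))"
  by pat_completeness auto
termination
  by (relation "measure (\<lambda>(ns, \<tau>, k). \<tau> - k)") auto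

declare scaled_hb.simps [simp del]

definition T_mat :: "(nat \<Rightarrow> nat) \<Rightarrow> nat \<Rightarrow> nat \<Rightarrow> real mat" where
  "T_mat ns \<tau> k =
     (if k < \<tau>
      then four_block_mat
             (hb11 ns \<tau> k) (hb12 ns \<tau> k)
             (transpose_mat (hb12 ns \<tau> k))
             ((real (tail_sum ns \<tau> k) / real (tail_sum ns \<tau> (k - 1))) \<cdot>\<^sub>m 1\<^sub>m (tail_sum ns \<tau> k))
      else scaled_hb ns \<tau> \<tau>)"

definition T_hat :: "(nat \<Rightarrow> nat) \<Rightarrow> nat \<Rightarrow> nat \<Rightarrow> real mat" where
  "T_hat ns \<tau> k = diag_block_mat (map (\<lambda>i. 1\<^sub>m (ns i)) [1..<k] @ [T_mat ns \<tau> k])"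

definition J0 :: "(nat \<Rightarrow> nat) \<Rightarrow> nat \<Rightarrow> real mat" where
  "J0 ns \<tau> = diag_block_mat (map (\<lambda>k. averaging_mat (ns k)) [1..<\<tau> + 1])"

definition mat_prod_list :: "nat \<Rightarrow> real mat list \<Rightarrow> real mat" where
  "mat_prod_list n As = foldr (*) As (1\<^sub>m n)"

definition A_L :: "(nat \<Rightarrow> nat) \<Rightarrow> nat \<Rightarrow> real mat" where
  "A_L ns \<tau> = mat_prod_list (tail_sum ns \<tau> 0) (map (T_hat ns \<tau>) [1..<\<tau> + 1])"

definition A_R :: "(nat \<Rightarrow> nat) \<Rightarrow> nat \<Rightarrow> real mat" where
  "A_R ns \<tau> = mat_prod_list (tail_sum ns \<tau> 0) (map (T_hat ns \<tau>) (rev [1..<\<tau> + 1]))"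

(* T(1) (I \<oplus> T(2) (I \<oplus> ... T(\<tau>-1) (I \<oplus> T(\<tau>)))) *)
definition A_L_nested :: "(nat \<Rightarrow> nat) \<Rightarrow> nat \<Rightarrow> real mat" where
  "A_L_nested ns \<tau> =
     foldr (\<lambda>k X. T_mat ns \<tau> k * diag_block_mat [1\<^sub>m (ns k), X]) [1..<\<tau>] (T_mat ns \<tau> \<tau>)"

(* (I \<oplus> ... (I \<oplus> (I \<oplus> T(\<tau>)) T(\<tau>-1)) T(\<tau>-2) ...) T(1): at each level the direct sum
   is formed first and then multiplied on the right by T(k). *)
definition A_R_nested :: "(nat \<Rightarrow> nat) \<Rightarrow> nat \<Rightarrow> real mat" where
  "A_R_nested ns \<tau> =
     foldr (\<lambda>k X. diag_block_mat [1\<^sub>m (ns k), X] * T_mat ns \<tau> k) [1..<\<tau>] (T_mat ns \<tau> \<tau>)"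

end

(* A_L satisfies L_j = T(j) (I (+) L_(j+1)) and J_0 splits as J_(n_j) (+) Q. Multiplying out the
   2x2 blocks of J_0 L_j J_0, every block is a constant matrix: the diagonal block of T(j) is only
   seen through the total of its entries, the off-diagonal blocks only through their constant
   column (row) sums because L_(j+1) and Q are doubly stochastic, and the last block is the
   induction hypothesis. Since all factors are symmetric, A_R is the transpose of A_L and J is
   symmetric, so the second factorization is the transpose of the first. *)
theory Submission
  imports Defs
begin

section \<open>Doubly stochastic matrices\<close>

lemma doubly_stochastic_iff:
  assumes "A \<in> carrier_mat n n"
  shows "doubly_stochastic A \<longleftrightarrow>
    (\<forall>i<n. \<forall>j<n. 0 \<le> A $$ (i, j)) \<and>
    (\<forall>i<n. (\<Sum>j<n. A $$ (i, j)) = 1) \<and> (\<forall>j<n. (\<Sum>i<n. A $$ (i, j)) = 1)"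
  using assms
  by (auto simp: doubly_stochastic_def ones_def vec_eq_iff scalar_prod_def atLeast0LessThan)

text \<open>Symmetry turns row sums into column sums, so for the matrices \<open>T k\<close> only
  the rows have to be computed.\<close>

lemma symmetric_doubly_stochasticI:
  assumes A: "A \<in> carrier_mat n n" and sym: "symmetric A"
    and nonneg: "\<And>i j. i < n \<Longrightarrow> j < n \<Longrightarrow> 0 \<le> A $$ (i, j)"
    and row: "\<And>i. i < n \<Longrightarrow> (\<Sum>j<n. A $$ (i, j)) = 1"
  shows "doubly_stochastic A"
proof -
  have "A $$ (i, j) = A $$ (j, i)" if "i < n" "j < n" for i j
    using sym A that unfolding symmetric_def by (metis carrier_matD index_transpose_mat(1))
  then have "(\<Sum>i<n. A $$ (i, j)) = 1" if "j < n" for j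
    using row[OF that] that by simp
  then show ?thesis
    using nonneg row by (simp add: doubly_stochastic_iff[OF A])
qed

lemma doubly_stochastic_transpose:
  assumes "doubly_stochastic A"
  shows "doubly_stochastic (transpose_mat A)"
  using assms by (auto simp: doubly_stochastic_def)

lemma doubly_stochastic_one: "doubly_stochastic (1\<^sub>m n)"
  by (simp add: doubly_stochastic_iff[of _ n] if_distrib cong: if_cong)

lemma doubly_stochastic_mult:
  assumes A: "A \<in> carrier_mat n n" "doubly_stochastic A"
    and B: "B \<in> carrier_mat n n" "doubly_stochastic B"
  shows "doubly_stochastic (A * B)"
proof -
  have ones: "ones n \<in> carrier_vec n"
    by (simp add: ones_def)
  have "0 \<le> (A * B) $$ (i, j)" if "i < n" "j < n" for i j
    using that A B by (auto simp: doubly_stochastic_def scalar_prod_def intro!: sum_nonneg)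
  moreover have "(A * B) *\<^sub>v ones n = ones n"
    using A B assoc_mult_mat_vec[OF A(1) B(1) ones] by (auto simp: doubly_stochastic_def)
  moreover have "transpose_mat (A * B) *\<^sub>v ones n = ones n"
  proof -
    have "transpose_mat B * transpose_mat A *\<^sub>v ones n
        = transpose_mat B *\<^sub>v (transpose_mat A *\<^sub>v ones n)"
      using A(1) B(1) ones by (intro assoc_mult_mat_vec) auto
    then show ?thesis
      using A B by (auto simp: doubly_stochastic_def transpose_mult[OF A(1) B(1)])
  qed
  ultimately show ?thesis
    using A(1) B(1) by (auto simp: doubly_stochastic_def)
qed

section \<open>Direct sums of two blocks\<close>

declare diag_block_mat.simps(2) [simp del]

text \<open>Reduces a direct sum of many blocks to nested binary ones, to which the lemmas below
  apply. As a rewrite rule it would match its own right-hand side, so later uses restrict the tail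
  to the shape of an append or a map.\<close>

lemma diag_block_mat_Cons:
  "diag_block_mat (A # As) = diag_block_mat [A, diag_block_mat As]"
  by (simp add: diag_block_mat.simps(2)[of A])

lemma diag_block_mat_pair:
  assumes "A \<in> carrier_mat a b" "B \<in> carrier_mat c d"
  shows "diag_block_mat [A, B] = four_block_mat A (0\<^sub>m a d) (0\<^sub>m c b) B"
  using assms by (simp add: diag_block_mat.simps(2)[of A])

lemma diag_block_mat_pair_carrier:
  assumes "A \<in> carrier_mat a b" "B \<in> carrier_mat c d"
  shows "diag_block_mat [A, B] \<in> carrier_mat (a + c) (b + d)"
  using assms by (simp add: diag_block_mat_pair[OF assms])

lemma transpose_diag_block_mat_pair:
  "transpose_mat (diag_block_mat [A, B]) = diag_block_mat [transpose_mat A, transpose_mat B]"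
  by (rule eq_matI) (auto simp: diag_block_mat.simps(2)[of _ "[_]"] Let_def)

lemma symmetric_diag_block_mat_pair:
  "symmetric A \<Longrightarrow> symmetric B \<Longrightarrow> symmetric (diag_block_mat [A, B])"
  unfolding symmetric_def transpose_diag_block_mat_pair by simp

lemma mult_diag_block_mat_pair:
  fixes A B C D :: "real mat"
  assumes "A \<in> carrier_mat a a" "B \<in> carrier_mat b b" "C \<in> carrier_mat a a" "D \<in> carrier_mat b b"
  shows "diag_block_mat [A, B] * diag_block_mat [C, D] = diag_block_mat [A * C, B * D]"
proof -
  have "A * C \<in> carrier_mat a a" "B * D \<in> carrier_mat b b"
    using assms by auto
  then show ?thesis
    using assms
    by (simp add: diag_block_mat_pair[of _ a a _ b b] mult_four_block_mat[of _ a a _ b _ b _ _ a _ b])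
qed

lemma doubly_stochastic_diag_block_mat_pair:
  assumes A: "A \<in> carrier_mat a a" "doubly_stochastic A"
    and B: "B \<in> carrier_mat b b" "doubly_stochastic B"
  shows "doubly_stochastic (diag_block_mat [A, B])"
proof -
  have dim: "dim_row A = a" "dim_col A = a" "dim_row B = b" "dim_col B = b"
    using A(1) B(1) by auto
  have c: "diag_block_mat [A, B] \<in> carrier_mat (a + b) (a + b)"
    by (rule diag_block_mat_pair_carrier[OF A(1) B(1)])
  have ones: "ones (a + b) = ones a @\<^sub>v ones b" "ones a \<in> carrier_vec a" "ones b \<in> carrier_vec b"
    by (auto simp: ones_def)
  \<comment> \<open>Stated for arbitrary \<open>C\<close> and \<open>D\<close> so that it serves
    \<open>A\<close>, \<open>B\<close> for the row sums and their transposes for the column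
    sums.\<close>
  have "diag_block_mat [C, D] *\<^sub>v ones (a + b) = ones (a + b)"
    if "C \<in> carrier_mat a a" "D \<in> carrier_mat b b" "C *\<^sub>v ones a = ones a" "D *\<^sub>v ones b = ones b"
    for C D
    using that ones
    by (simp add: diag_block_mat_pair[OF that(1,2)] mult_mat_vec_split[of _ a _ b])
  moreover have "0 \<le> diag_block_mat [A, B] $$ (i, j)" if "i < a + b" "j < a + b" for i j
    using that A(2) B(2) unfolding diag_block_mat_pair[OF A(1) B(1)]
    by (auto simp: dim doubly_stochastic_def)
  ultimately show ?thesis
    using A B c unfolding doubly_stochastic_def transpose_diag_block_mat_pair by (auto simp: dim)
qed

section \<open>Averaging and constant matrices\<close>

abbreviation const_mat :: "nat \<Rightarrow> nat \<Rightarrow> real \<Rightarrow> real mat" where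
  "const_mat a b c \<equiv> mat a b (\<lambda>_. c)"

lemma averaging_mat_conv: "averaging_mat r = const_mat r r (1 / real r)"
  by (rule eq_matI) (auto simp: averaging_mat_def ones_def mat_of_cols_def scalar_prod_def)

lemma averaging_mat_carrier [simp]: "averaging_mat r \<in> carrier_mat r r"
  by (simp add: averaging_mat_conv)

lemma averaging_mat_dim [simp]: "dim_row (averaging_mat r) = r" "dim_col (averaging_mat r) = r"
  by (simp_all add: averaging_mat_conv)

lemma symmetric_averaging_mat: "symmetric (averaging_mat r)"
  by (auto simp: symmetric_def averaging_mat_conv)

lemma doubly_stochastic_averaging_mat: "r > 0 \<Longrightarrow> doubly_stochastic (averaging_mat r)"
  by (simp add: doubly_stochastic_iff[of _ r]) (simp add: averaging_mat_conv)

text \<open>Every row of the constant matrix is a multiple of the all-ones row, which sees only the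
  column sums of \<open>M\<close>.\<close>

lemma const_mat_mult:
  assumes "M \<in> carrier_mat b c" "\<And>j. j < c \<Longrightarrow> (\<Sum>i<b. M $$ (i, j)) = s"
  shows "const_mat a b x * M = const_mat a c (x * s)"
  using assms
  by (intro eq_matI) (auto simp: scalar_prod_def atLeast0LessThan simp flip: sum_distrib_left)

lemma mult_const_mat:
  assumes "M \<in> carrier_mat a b" "\<And>i. i < a \<Longrightarrow> (\<Sum>j<b. M $$ (i, j)) = s"
  shows "M * const_mat b c x = const_mat a c (s * x)"
  using assms
  by (intro eq_matI) (auto simp: scalar_prod_def atLeast0LessThan simp flip: sum_distrib_right)

text \<open>Between two constant matrices only the total of all entries of \<open>M\<close>
  survives, so \<open>M\<close> needs neither constant row sums nor constant column sums.\<close>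

lemma const_mat_mult_const_mat:
  assumes "M \<in> carrier_mat b c"
  shows "const_mat a b x * M * const_mat c d y
    = const_mat a d (x * (\<Sum>i<b. \<Sum>j<c. M $$ (i, j)) * y)"
proof -
  have "(\<Sum>j<c. \<Sum>i<b. x * M $$ (i, j)) = x * (\<Sum>i<b. \<Sum>j<c. M $$ (i, j))"
    by (subst sum.swap) (simp add: sum_distrib_left)
  then show ?thesis
    using assms
    by (intro eq_matI) (auto simp: scalar_prod_def atLeast0LessThan simp flip: sum_distrib_right)
qed

text \<open>The inductive step of the factorization, freed from the partition: \<open>H\<close> and
  \<open>K\<close> stand for the blocks \<open>hb11\<close> and \<open>hb12\<close>,
  \<open>A\<close> for the nested product and \<open>Q\<close> for the direct sum of averaging
  matrices on the remaining blocks.\<close>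

lemma averaging_four_block:
  assumes p: "p > 0" and q: "q > 0"
    and H: "H \<in> carrier_mat p p"
      "(\<Sum>i<p. \<Sum>j<p. H $$ (i, j)) = (real p)\<^sup>2 / real (p + q)"
    and K: "K \<in> carrier_mat p q"
      "\<And>j. j < q \<Longrightarrow> (\<Sum>i<p. K $$ (i, j)) = real p / real (p + q)"
    and A: "A \<in> carrier_mat q q" "doubly_stochastic A"
    and Q: "Q \<in> carrier_mat q q" "doubly_stochastic Q"
    and QAQ: "Q * A * Q = averaging_mat q"
  shows "diag_block_mat [averaging_mat p, Q] *
      (four_block_mat H K (transpose_mat K) ((real q / real (p + q)) \<cdot>\<^sub>m 1\<^sub>m q)
        * diag_block_mat [1\<^sub>m p, A]) *
      diag_block_mat [averaging_mat p, Q] = averaging_mat (p + q)"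
    (is "?J * (four_block_mat _ _ ?Kt ?D * ?A) * ?J = _")
proof -
  let ?P = "averaging_mat p" and ?c = "1 / real (p + q)"
  \<comment> \<open>The block rules mention some sizes only in their premises, where rewriting
    cannot find them; hence the explicit instances.\<close>
  note blocks = diag_block_mat_pair[of _ p p _ q q]
  note mult = mult_four_block_mat[of _ p p _ q _ q _ _ p _ q]
    left_add_zero_mat[of _ p p] left_add_zero_mat[of _ p q]
    left_add_zero_mat[of _ q p] left_add_zero_mat[of _ q q]
    right_add_zero_mat[of _ p p] right_add_zero_mat[of _ p q]
    right_add_zero_mat[of _ q p] right_add_zero_mat[of _ q q]
    mult_carrier_mat[of _ p p _ p] mult_carrier_mat[of _ p p _ q] mult_carrier_mat[of _ p q _ q]
    mult_carrier_mat[of _ q q _ q] mult_carrier_mat[of _ q q _ p] mult_carrier_mat[of _ q p _ p]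
  have Kt: "?Kt \<in> carrier_mat q p" using K by simp
  have D: "?D * A = (real q / real (p + q)) \<cdot>\<^sub>m A"
    using A by (simp add: mult_smult_assoc_mat[of _ q q])
  \<comment> \<open>Keeps the lower right block opaque during the block multiplications; it is
    expanded only where the induction hypothesis \<open>QAQ\<close> applies.\<close>
  define E where "E = ?D * A"
  have E: "E \<in> carrier_mat q q"
    using A(1) unfolding E_def by (intro mult_carrier_mat[of _ q q]) auto
  have "four_block_mat H K ?Kt ?D * ?A = four_block_mat H (K * A) ?Kt E"
    using H(1) K(1) Kt A(1) E unfolding E_def
    by (simp add: blocks mult)
  then have "?J * (four_block_mat H K ?Kt ?D * ?A) =
      four_block_mat (?P * H) (?P * (K * A)) (Q * ?Kt) (Q * E)"
    using H(1) K(1) Kt A(1) Q(1) E by (simp add: blocks mult)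
  moreover have "four_block_mat (?P * H) (?P * (K * A)) (Q * ?Kt) (Q * E) * ?J =
      four_block_mat (?P * H * ?P) (?P * (K * A) * Q) (Q * ?Kt * ?P) (Q * E * Q)"
    using H(1) K(1) Kt A(1) Q(1) E by (simp add: blocks mult)
  \<comment> \<open>The two factors 1/p cancel the p^2 in the total of \<open>H\<close>.\<close>
  moreover have "?P * H * ?P = const_mat p p ?c"
    using p by (simp add: averaging_mat_conv const_mat_mult_const_mat[OF H(1)] H(2) power2_eq_square)
  moreover have "?P * (K * A) * Q = const_mat p q ?c"
  proof -
    \<comment> \<open>Regrouping lets the constant matrix meet \<open>K\<close>, \<open>A\<close>
      and \<open>Q\<close> in turn: \<open>K\<close> rescales the constant to 1/(p + q), and the
      unit column sums of \<open>A\<close> and \<open>Q\<close> preserve it.\<close>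
    have "?P * (K * A) * Q = ?P * K * A * Q"
      using K(1) A(1) by (simp add: assoc_mult_mat[of _ p p _ q _ q])
    then show ?thesis
      using p A Q by (simp add: averaging_mat_conv const_mat_mult[OF K] const_mat_mult[of _ q q 1]
          doubly_stochastic_iff[OF A(1)] doubly_stochastic_iff[OF Q(1)])
  qed
  moreover have "Q * ?Kt * ?P = const_mat q p ?c"
  proof -
    \<comment> \<open>The row sums of \<open>?Kt\<close> are the column sums of \<open>K\<close>, so
      this product is already constant before \<open>Q\<close> acts.\<close>
    have "?Kt * ?P = const_mat q p ?c"
      using p mult_const_mat[OF Kt, of "real p / real (p + q)" p "1 / real p"] K
      by (simp add: averaging_mat_conv)
    then have "Q * ?Kt * ?P = Q * const_mat q p ?c"
      using Q(1) Kt by (simp add: assoc_mult_mat[of _ q q _ p _ p])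
    then show ?thesis
      using Q by (simp add: mult_const_mat[of _ q q 1] doubly_stochastic_iff[OF Q(1)])
  qed
  moreover have "Q * E * Q = const_mat q q ?c"
  proof -
    have "Q * E * Q = (real q / real (p + q)) \<cdot>\<^sub>m (Q * A * Q)"
      using A(1) Q(1) by (simp add: E_def D mult_smult_distrib[of _ q q] mult_smult_assoc_mat[of _ q q])
    also have "\<dots> = const_mat q q ?c"
      using q unfolding QAQ averaging_mat_conv by (intro eq_matI) auto
    finally show ?thesis .
  qed
  moreover have "four_block_mat (const_mat p p ?c) (const_mat p q ?c) (const_mat q p ?c)
      (const_mat q q ?c) = averaging_mat (p + q)"
    unfolding averaging_mat_conv by (intro eq_matI) auto
  ultimately show ?thesis by simp
qed

section \<open>Products of lists of square matrices\<close>

lemma mat_prod_list_Nil [simp]: "mat_prod_list n [] = 1\<^sub>m n"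
  and mat_prod_list_Cons [simp]: "mat_prod_list n (A # As) = A * mat_prod_list n As"
  by (simp_all add: mat_prod_list_def)

lemma mat_prod_list_carrier:
  assumes "set As \<subseteq> carrier_mat n n"
  shows "mat_prod_list n As \<in> carrier_mat n n"
  using assms by (induction As) auto

lemma mat_prod_list_append:
  assumes "set As \<subseteq> carrier_mat n n" "set Bs \<subseteq> carrier_mat n n"
  shows "mat_prod_list n (As @ Bs) = mat_prod_list n As * mat_prod_list n Bs"
  using assms
proof (induction As)
  case Nil
  then show ?case by (simp add: left_mult_one_mat[of _ n n] mat_prod_list_carrier)
next
  case (Cons A As)
  then show ?case
    by (simp add: assoc_mult_mat[of _ n n _ n _ n] mat_prod_list_carrier)
qed

text \<open>Transposition reverses a product and fixes each symmetric factor. This makes the right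
  factor the transpose of the left one.\<close>

lemma mat_prod_list_rev:
  assumes "set As \<subseteq> carrier_mat n n" "\<And>A. A \<in> set As \<Longrightarrow> symmetric A"
  shows "mat_prod_list n (rev As) = transpose_mat (mat_prod_list n As)"
  using assms
proof (induction As)
  case Nil
  then show ?case by simp
next
  case (Cons A As)
  then have A: "A \<in> carrier_mat n n" "transpose_mat A = A" 
    by (auto simp: symmetric_def)
  have "mat_prod_list n (rev (A # As)) = mat_prod_list n (rev As) * A"
    using Cons.prems A by (simp add: mat_prod_list_append right_mult_one_mat[OF A(1)])
  then show ?case
    using Cons A by (simp add: transpose_mult[of _ n n _ n] mat_prod_list_carrier)
qed

text \<open>A common identity summand can be pulled out of a product; this is what turns the product
  of augmented matrices into the nested form.\<close>

lemma mat_prod_list_diag_block: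
  assumes "set As \<subseteq> carrier_mat b b"
  shows "mat_prod_list (a + b) (map (\<lambda>A. diag_block_mat [1\<^sub>m a, A]) As)
    = diag_block_mat [1\<^sub>m a, mat_prod_list b As]"
  using assms
proof (induction As)
  case Nil
  then show ?case by (simp add: diag_block_mat_pair[of _ a a _ b b])
next
  case (Cons A As)
  then show ?case
    by (simp add: mult_diag_block_mat_pair[of _ a _ b] mat_prod_list_carrier)
qed

lemma sum_lessThan_add:
  fixes f :: "nat \<Rightarrow> 'a::comm_monoid_add"
  shows "(\<Sum>i<a + b. f i) = (\<Sum>i<a. f i) + (\<Sum>i<b. f (a + i))"
  by (induction b) (simp_all add: ac_simps)

section \<open>The partition, its tails, and the matrices \<open>T k\<close>\<close>

locale hb_partition =
  fixes ns :: "nat \<Rightarrow> nat" and \<tau> :: nat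
  assumes pos: "k \<in> {1..\<tau>} \<Longrightarrow> ns k \<ge> 1"
    and dominant: "k \<in> {1..<\<tau>} \<Longrightarrow> ns k \<ge> tail_sum ns \<tau> k"
begin

abbreviation T :: "nat \<Rightarrow> real mat" where
  "T \<equiv> T_mat ns \<tau>"

abbreviation m :: "nat \<Rightarrow> nat" where
  "m \<equiv> tail_sum ns \<tau>"

text \<open>The index \<open>j\<close> below restricts a construction to the blocks \<open>j, \<dots>, \<tau>\<close>,
  which gives matrices of size \<open>m (j - 1)\<close>; \<open>j = 1\<close> is the full partition.\<close>

definition T_hat_from :: "nat \<Rightarrow> nat \<Rightarrow> real mat" where
  "T_hat_from j k = diag_block_mat (map (\<lambda>i. 1\<^sub>m (ns i)) [j..<k] @ [T k])"

definition J0_from :: "nat \<Rightarrow> real mat" where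
  "J0_from j = diag_block_mat (map (\<lambda>k. averaging_mat (ns k)) [j..<\<tau> + 1])"

definition nested_L :: "nat \<Rightarrow> real mat" where
  "nested_L j = foldr (\<lambda>k X. T k * diag_block_mat [1\<^sub>m (ns k), X]) [j..<\<tau>] (T \<tau>)"

definition nested_R :: "nat \<Rightarrow> real mat" where
  "nested_R j = foldr (\<lambda>k X. diag_block_mat [1\<^sub>m (ns k), X] * T k) [j..<\<tau>] (T \<tau>)"

lemma m_rec: "k \<in> {1..\<tau>} \<Longrightarrow> m (k - 1) = ns k + m k"
  by (simp add: tail_sum_def sum.atLeast_Suc_atMost)

lemma m_pos:
  assumes "k < \<tau>"
  shows "m k > 0"
  using m_rec[of "Suc k"] pos[of "Suc k"] assms by simp

lemma m_last: "m \<tau> = 0"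
  by (simp add: tail_sum_def)

text \<open>The nested matrices grow by putting a block in front, so the induction starts at the
  last block and runs down.\<close>

lemma downward_induct [consumes 1, case_names last step]:
  assumes "j \<in> {1..\<tau>}" "P \<tau>"
    and "\<And>j. j \<in> {1..<\<tau>} \<Longrightarrow> P (Suc j) \<Longrightarrow> P j"
  shows "P j"
proof -
  have "j \<le> \<tau>" using assms(1) by simp
  then show ?thesis
    using assms by (induction rule: inc_induct) auto
qed

lemma T_hat_from_Suc:
  "j < k \<Longrightarrow> T_hat_from j k = diag_block_mat [1\<^sub>m (ns j), T_hat_from (Suc j) k]"
  by (simp add: T_hat_from_def upt_conv_Cons diag_block_mat_Cons[of _ "_ @ _"])

lemma T_hat_from_self: "T_hat_from j j = T j"
  by (simp add: T_hat_from_def)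

lemma J0_from_Suc:
  "j < \<tau> \<Longrightarrow> J0_from j = diag_block_mat [averaging_mat (ns j), J0_from (Suc j)]"
  unfolding J0_from_def
  by (subst upt_conv_Cons) (simp_all add: diag_block_mat_Cons[of _ "map _ _"] del: upt_Suc)

lemma J0_from_last: "J0_from \<tau> = averaging_mat (ns \<tau>)"
  by (simp add: J0_from_def)

lemma nested_L_Suc:
  "j < \<tau> \<Longrightarrow> nested_L j = T j * diag_block_mat [1\<^sub>m (ns j), nested_L (Suc j)]"
  by (simp add: nested_L_def upt_conv_Cons)

lemma nested_R_Suc:
  "j < \<tau> \<Longrightarrow> nested_R j = diag_block_mat [1\<^sub>m (ns j), nested_R (Suc j)] * T j"
  by (simp add: nested_R_def upt_conv_Cons)

lemma nested_last: "nested_L \<tau> = T \<tau>" "nested_R \<tau> = T \<tau>"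
  by (simp_all add: nested_L_def nested_R_def)

lemma T_last: "T \<tau> = 1\<^sub>m (ns \<tau>)"
  by (simp add: T_mat_def scaled_hb.simps)

lemma T_four_block:
  "k < \<tau> \<Longrightarrow> T k = four_block_mat (hb11 ns \<tau> k) (hb12 ns \<tau> k)
    (transpose_mat (hb12 ns \<tau> k)) ((real (m k) / real (m (k - 1))) \<cdot>\<^sub>m 1\<^sub>m (m k))"
  by (simp add: T_mat_def)

lemma hb_carrier:
  "hb11 ns \<tau> k \<in> carrier_mat (ns k) (ns k)" "hb12 ns \<tau> k \<in> carrier_mat (ns k) (m k)"
  by (simp_all add: hb11_def hb12_def)

lemma T_carrier:
  assumes "k \<in> {1..\<tau>}"
  shows "T k \<in> carrier_mat (m (k - 1)) (m (k - 1))"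
proof (cases "k < \<tau>")
  case True
  then show ?thesis
    unfolding T_four_block[OF True] m_rec[OF assms]
    by (intro four_block_carrier_mat hb_carrier) simp
next
  case False
  then show ?thesis
    using assms m_rec[OF assms] by (simp add: T_last m_last)
qed

lemma symmetric_T: "k \<le> \<tau> \<Longrightarrow> symmetric (T k)"
proof (cases "k < \<tau>")
  case True
  have "transpose_mat (hb11 ns \<tau> k) = hb11 ns \<tau> k"
    by (auto simp: hb11_def mat_diag_def)
  then show ?thesis
    unfolding T_four_block[OF True] symmetric_def
    by (subst transpose_four_block_mat[OF hb_carrier])
      (auto simp: hb_carrier intro!: cong_four_block_mat eq_matI)
qed (simp add: T_last symmetric_def)

text \<open>With p = \<open>ns k\<close> and q = \<open>m k\<close>, a row either holds the two
  nonzero entries q/(p + q) and p/(p + q) or, for q \<le> i < p, a single 1 on the diagonal.\<close>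

lemma doubly_stochastic_T:
  assumes k: "k \<in> {1..\<tau>}"
  shows "doubly_stochastic (T k)"
proof (cases "k < \<tau>")
  case True
  let ?p = "ns k" and ?q = "m k"
  have le: "?q \<le> ?p" and p: "?p > 0"
    using dominant[of k] pos[of k] k True by auto
  have s: "real ?q / real (?p + ?q) + real ?p / real (?p + ?q) = 1"
    using p by (simp flip: add_divide_distrib)
  show ?thesis
  proof (rule symmetric_doubly_stochasticI[OF T_carrier[OF k]])
    show "symmetric (T k)" using k by (simp add: symmetric_T)
    fix i assume i: "i < m (k - 1)"
    show "0 \<le> T k $$ (i, j)" if "j < m (k - 1)" for j
      using i that unfolding T_four_block[OF True] m_rec[OF k]
      by (auto simp: hb11_def hb12_def mat_diag_def)
    show "(\<Sum>j<m (k - 1). T k $$ (i, j)) = 1"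
    proof (cases "i < ?p")
      case i_less: True
      have "(\<Sum>j<m (k - 1). T k $$ (i, j)) =
          (\<Sum>j<?p. if j = i then if i < ?q then real ?q / real (?p + ?q) else 1 else 0) +
          (\<Sum>j<?q. if j = i then real ?p / real (?p + ?q) else 0)"
        unfolding T_four_block[OF True] hb11_def hb12_def m_rec[OF k] sum_lessThan_add
        using i_less by (intro arg_cong2[where f = "(+)"] sum.cong) (auto simp: mat_diag_def)
      then show ?thesis
        using i_less s by simp
    next
      \<comment> \<open>The off-diagonal entry of a lower row sits in column i - p. It lies inside
        the transposed block because q \<le> p, which is where the dominance assumption
        enters.\<close>
      case i_ge: False
      have "(\<Sum>j<m (k - 1). T k $$ (i, j)) =
          (\<Sum>j<?p. if j = i - ?p then real ?p / real (?p + ?q) else 0) +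
          (\<Sum>j<?q. if j = i - ?p then real ?q / real (?p + ?q) else 0)"
        unfolding T_four_block[OF True] hb11_def hb12_def m_rec[OF k] sum_lessThan_add
        using i_ge i[unfolded m_rec[OF k]]
        by (intro arg_cong2[where f = "(+)"] sum.cong) (auto simp: mat_diag_def)
      moreover have "i - ?p < ?q" "i - ?p < ?p"
        using i_ge i[unfolded m_rec[OF k]] le by auto
      ultimately show ?thesis
        using s by simp
    qed
  qed
next
  case False
  then show ?thesis using k by (simp add: T_last doubly_stochastic_one)
qed

section \<open>Direct sums and nested products over a tail of the partition\<close>

lemma T_hat_from_props:
  assumes "j \<in> {1..k}" "k \<le> \<tau>"
  shows "T_hat_from j k \<in> carrier_mat (m (j - 1)) (m (j - 1)) \<and>
    symmetric (T_hat_from j k) \<and> doubly_stochastic (T_hat_from j k)"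
proof -
  have "j \<le> k" using assms by simp
  then show ?thesis
    using assms
  proof (induction rule: inc_induct)
    case base
    then show ?case
      using T_carrier[of k] symmetric_T[of k] doubly_stochastic_T[of k] by (simp add: T_hat_from_self)
  next
    case (step j)
    then have IH: "T_hat_from (Suc j) k \<in> carrier_mat (m j) (m j)"
        "symmetric (T_hat_from (Suc j) k)" "doubly_stochastic (T_hat_from (Suc j) k)"
      and m: "m (j - 1) = ns j + m j"
      using m_rec[of j] by auto
    show ?case
      unfolding T_hat_from_Suc[OF \<open>j < k\<close>] m
      using IH by (intro conjI diag_block_mat_pair_carrier symmetric_diag_block_mat_pair
          doubly_stochastic_diag_block_mat_pair doubly_stochastic_one) (auto simp: symmetric_def)
  qed
qed

lemma J0_from_props:
  assumes "j \<in> {1..\<tau>}"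
  shows "J0_from j \<in> carrier_mat (m (j - 1)) (m (j - 1)) \<and>
    symmetric (J0_from j) \<and> doubly_stochastic (J0_from j)"
  using assms
proof (induction rule: downward_induct)
  case last
  then show ?case
    using m_rec[of \<tau>] pos[of \<tau>] assms
    by (simp add: J0_from_last m_last symmetric_averaging_mat doubly_stochastic_averaging_mat)
next
  case (step j)
  then have m: "m (j - 1) = ns j + m j" and "j < \<tau>" "ns j > 0"
    using m_rec[of j] pos[of j] by auto
  then show ?case
    unfolding J0_from_Suc[OF \<open>j < \<tau>\<close>] m
    using step by (intro conjI diag_block_mat_pair_carrier symmetric_diag_block_mat_pair
        doubly_stochastic_diag_block_mat_pair[of _ "ns j" _ "m j"] doubly_stochastic_averaging_mat
        symmetric_averaging_mat averaging_mat_carrier) auto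
qed

lemma nested_L_props:
  assumes "j \<in> {1..\<tau>}"
  shows "nested_L j \<in> carrier_mat (m (j - 1)) (m (j - 1)) \<and> doubly_stochastic (nested_L j)"
  using assms
proof (induction rule: downward_induct)
  case last
  then show ?case
    using assms T_carrier[of \<tau>] doubly_stochastic_T[of \<tau>] by (simp add: nested_last)
next
  case (step j)
  let ?B = "diag_block_mat [1\<^sub>m (ns j), nested_L (Suc j)]"
  have j: "j \<in> {1..\<tau>}" "j < \<tau>" using step by auto
  have "?B \<in> carrier_mat (m (j - 1)) (m (j - 1))" "doubly_stochastic ?B"
    using step unfolding m_rec[OF j(1)]
    by (auto intro!: diag_block_mat_pair_carrier doubly_stochastic_diag_block_mat_pair
        doubly_stochastic_one)
  then show ?case
    unfolding nested_L_Suc[OF j(2)]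
    using T_carrier[OF j(1)] doubly_stochastic_T[OF j(1)] doubly_stochastic_mult by auto
qed

text \<open>Transposing reverses the product at each level, and both \<open>T j\<close> and the
  identity summand are symmetric.\<close>

lemma nested_R_transpose:
  assumes "j \<in> {1..\<tau>}"
  shows "nested_R j = transpose_mat (nested_L j)"
  using assms
proof (induction rule: downward_induct)
  case last
  then show ?case using symmetric_T[of \<tau>] by (simp add: nested_last symmetric_def)
next
  case (step j)
  let ?B = "diag_block_mat [1\<^sub>m (ns j), nested_L (Suc j)]"
  have j: "j \<in> {1..\<tau>}" "j < \<tau>" using step by auto
  have "?B \<in> carrier_mat (m (j - 1)) (m (j - 1))"
    using step nested_L_props[of "Suc j"] unfolding m_rec[OF j(1)]
    by (intro diag_block_mat_pair_carrier) auto
  then have "transpose_mat (nested_L j) = transpose_mat ?B * transpose_mat (T j)"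
    unfolding nested_L_Suc[OF j(2)] using T_carrier[OF j(1)] by (intro transpose_mult) auto
  then show ?case
    using step symmetric_T[of j]
    by (simp add: nested_R_Suc transpose_diag_block_mat_pair symmetric_def)
qed

section \<open>The factorization of the averaging matrix\<close>

lemma hb11_total:
  assumes "k \<in> {1..<\<tau>}"
  shows "(\<Sum>i<ns k. \<Sum>j<ns k. hb11 ns \<tau> k $$ (i, j)) = (real (ns k))\<^sup>2 / real (ns k + m k)"
proof -
  let ?p = "ns k" and ?q = "m k"
  have le: "?q \<le> ?p" and p: "?p > 0" and m: "m (k - 1) = ?p + ?q"
    using dominant[of k] pos[of k] m_rec[of k] assms by auto
  have "(\<Sum>i<?p. \<Sum>j<?p. hb11 ns \<tau> k $$ (i, j))
      = (\<Sum>i<?q + (?p - ?q). if i < ?q then real ?q / real (?p + ?q) else 1)"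
    using le unfolding hb11_def m by (simp add: mat_diag_def)
  also have "\<dots> = real ?q * (real ?q / real (?p + ?q)) + real (?p - ?q)"
    by (subst sum_lessThan_add) simp
  \<comment> \<open>Over the common denominator this is q^2 + (p - q)(p + q) = p^2; q \<le> p makes
    the natural-number difference exact.\<close>
  also have "\<dots> = (real ?p)\<^sup>2 / real (?p + ?q)"
    using le p by (simp add: of_nat_diff field_simps power2_eq_square)
  finally show ?thesis .
qed

text \<open>Each column has exactly one nonzero entry, in the row of the same index; that row exists
  because \<open>m k\<close> is at most \<open>ns k\<close>.\<close>

lemma hb12_col_sum:
  assumes "k \<in> {1..<\<tau>}" "j < m k"
  shows "(\<Sum>i<ns k. hb12 ns \<tau> k $$ (i, j)) = real (ns k) / real (ns k + m k)"
  using assms dominant[of k] m_rec[of k] by (simp add: hb12_def)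

text \<open>For the last block this is idempotence of the averaging matrix, since
  \<open>T \<tau>\<close> is the identity; each earlier block is one use of
  \<open>averaging_four_block\<close>.\<close>

lemma averaging_nested_L:
  assumes "j \<in> {1..\<tau>}"
  shows "J0_from j * nested_L j * J0_from j = averaging_mat (m (j - 1))"
  using assms
proof (induction rule: downward_induct)
  case last
  have "ns \<tau> > 0" using pos[of \<tau>] assms by simp
  then have "averaging_mat (ns \<tau>) * averaging_mat (ns \<tau>) = averaging_mat (ns \<tau>)"
    using const_mat_mult[of "averaging_mat (ns \<tau>)" "ns \<tau>" "ns \<tau>" 1 "ns \<tau>" "1 / real (ns \<tau>)"]
    by (simp add: averaging_mat_conv)
  then show ?case
    using assms m_rec[of \<tau>]
    by (simp add: J0_from_last nested_last T_last m_last right_mult_one_mat[of _ "ns \<tau>"])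
next
  case (step j)
  then have j: "j \<in> {1..\<tau>}" "j < \<tau>" by auto
  have "ns j > 0" "m j > 0" using pos[of j] m_pos[of j] j by auto
  then show ?case
    unfolding J0_from_Suc[OF j(2)] nested_L_Suc[OF j(2)] T_four_block[OF j(2)] m_rec[OF j(1)]
    using step nested_L_props[of "Suc j"] J0_from_props[of "Suc j"]
    by (intro averaging_four_block hb_carrier hb11_total hb12_col_sum) auto
qed

text \<open>The first factor is \<open>T j\<close> itself. All later factors share the identity
  summand of block j, and pulling it out leaves the same product for the shorter tail.\<close>

lemma mat_prod_list_T_hat_from:
  assumes "j \<in> {1..\<tau>}"
  shows "mat_prod_list (m (j - 1)) (map (T_hat_from j) [j..<\<tau> + 1]) = nested_L j"
  using assms
proof (induction rule: downward_induct)
  case last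
  then show ?case
    using T_carrier[of \<tau>] assms by (simp add: T_hat_from_self nested_last)
next
  case (step j)
  then have j: "j \<in> {1..\<tau>}" "j < \<tau>" by auto
  let ?As = "map (T_hat_from (Suc j)) [Suc j..<\<tau> + 1]"
  have As: "set ?As \<subseteq> carrier_mat (m j) (m j)"
    using T_hat_from_props[of "Suc j"] by auto
  have "map (T_hat_from j) [j..<\<tau> + 1] = T j # map (\<lambda>A. diag_block_mat [1\<^sub>m (ns j), A]) ?As"
    using j by (subst upt_conv_Cons) (auto simp: T_hat_from_self T_hat_from_Suc simp del: upt_Suc)
  then have "mat_prod_list (m (j - 1)) (map (T_hat_from j) [j..<\<tau> + 1])
      = T j * mat_prod_list (ns j + m j) (map (\<lambda>A. diag_block_mat [1\<^sub>m (ns j), A]) ?As)"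
    by (simp only: mat_prod_list_Cons m_rec[OF j(1)])
  also have "\<dots> = nested_L j"
    using step.IH by (simp only: mat_prod_list_diag_block[OF As] nested_L_Suc[OF j(2)] diff_Suc_1)
  finally show ?case .
qed

lemma J0_conv: "J0 ns \<tau> = J0_from 1"
  by (simp add: J0_def J0_from_def)

lemma T_hat_conv: "T_hat ns \<tau> = T_hat_from 1"
  by (rule ext) (simp add: T_hat_def T_hat_from_def)

lemma A_L_nested_conv: "A_L_nested ns \<tau> = nested_L 1"
  by (simp add: A_L_nested_def nested_L_def)

lemma A_R_nested_conv: "A_R_nested ns \<tau> = nested_R 1"
  by (simp add: A_R_nested_def nested_R_def)

lemma A_L_conv: "\<tau> \<ge> 1 \<Longrightarrow> A_L ns \<tau> = nested_L 1"
  using mat_prod_list_T_hat_from[of 1] by (simp add: A_L_def T_hat_conv)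

lemma A_R_conv:
  assumes "\<tau> \<ge> 1"
  shows "A_R ns \<tau> = transpose_mat (nested_L 1)"
proof -
  let ?As = "map (T_hat ns \<tau>) [1..<\<tau> + 1]"
  have "mat_prod_list (m 0) (rev ?As) = transpose_mat (mat_prod_list (m 0) ?As)"
    using T_hat_from_props[of 1] by (intro mat_prod_list_rev) (auto simp: T_hat_conv)
  then show ?thesis
    using A_L_conv[OF assms] by (simp add: A_R_def A_L_def rev_map)
qed

end

theorem theorem3:
  fixes n \<tau> :: nat and ns :: "nat \<Rightarrow> nat"
  assumes "n \<ge> 2"
    and "n = (\<Sum>k = 1..\<tau>. ns k)"
    and "\<And>k. k \<in> {1..\<tau>} \<Longrightarrow> ns k \<ge> 1"
    and "\<And>k. k \<in> {1..<\<tau>} \<Longrightarrow> ns k \<ge> tail_sum ns \<tau> k"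
  shows "(\<forall>k \<in> {1..\<tau>}.
            T_mat ns \<tau> k \<in> carrier_mat (tail_sum ns \<tau> (k - 1)) (tail_sum ns \<tau> (k - 1)) \<and>
            symmetric (T_mat ns \<tau> k) \<and> doubly_stochastic (T_mat ns \<tau> k) \<and>
            T_hat ns \<tau> k \<in> carrier_mat n n \<and>
            symmetric (T_hat ns \<tau> k) \<and> doubly_stochastic (T_hat ns \<tau> k)) \<and>
         averaging_mat n = J0 ns \<tau> * A_L ns \<tau> * J0 ns \<tau> \<and>
         averaging_mat n = J0 ns \<tau> * A_R ns \<tau> * J0 ns \<tau> \<and>
         A_L ns \<tau> = A_L_nested ns \<tau> \<and>
         A_R ns \<tau> = A_R_nested ns \<tau> \<and>
         doubly_stochastic (A_L ns \<tau>) \<and>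
         doubly_stochastic (A_R ns \<tau>)"
proof -
  interpret hb_partition ns \<tau>
    using assms(3,4) by unfold_locales auto
  have n: "n = m 0"
    using assms(2) by (simp add: tail_sum_def)
  \<comment> \<open>An empty partition would force n = 0.\<close>
  have \<tau>: "\<tau> \<ge> 1"
    using assms(1,2) by (cases \<tau>) auto
  let ?J = "J0_from 1" and ?L = "nested_L 1"
  have J: "?J \<in> carrier_mat n n" "transpose_mat ?J = ?J"
    and L: "?L \<in> carrier_mat n n" "doubly_stochastic ?L"
    using J0_from_props[of 1] nested_L_props[of 1] \<tau> by (auto simp: n symmetric_def)
  have JLJ: "?J * ?L * ?J = averaging_mat n"
    using averaging_nested_L[of 1] \<tau> by (simp add: n)
  \<comment> \<open>The right factorization is the transpose of the left one: both outer factors and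
    the averaging matrix are symmetric.\<close>
  have "averaging_mat n = transpose_mat (?J * ?L * ?J)"
    using symmetric_averaging_mat[of n] by (simp only: JLJ symmetric_def)
  also have "\<dots> = ?J * (transpose_mat ?L * ?J)"
    using J L by (simp add: transpose_mult[of _ n n _ n])
  also have "\<dots> = ?J * transpose_mat ?L * ?J"
    using J(1) L(1) by (intro assoc_mult_mat[symmetric]) auto
  finally have JRJ: "averaging_mat n = ?J * transpose_mat ?L * ?J" .
  have "\<forall>k\<in>{1..\<tau>}. T k \<in> carrier_mat (m (k - 1)) (m (k - 1)) \<and>
      symmetric (T k) \<and> doubly_stochastic (T k) \<and>
      T_hat ns \<tau> k \<in> carrier_mat n n \<and>
      symmetric (T_hat ns \<tau> k) \<and> doubly_stochastic (T_hat ns \<tau> k)"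
    using T_carrier symmetric_T doubly_stochastic_T T_hat_from_props[of 1]
    by (auto simp: T_hat_conv n)
  then show ?thesis
    using JLJ JRJ L(2) doubly_stochastic_transpose[OF L(2)] nested_R_transpose[of 1] \<tau>
    by (simp add: J0_conv A_L_conv A_R_conv A_L_nested_conv A_R_nested_conv)
qed

end
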